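(* Let $\mathbf F:\mathbf X\to\mathbf Y$ and $\mathbf G:\mathbf Y\to\mathbf Z$ be omega pseudo-functors between weak omega categories. Then $\mathbf G\circ\mathbf F=(G_1\circ F_1,G_2\circ F_2,G_3\circ F_3)$ is an omega pseudo-functor.
   Context: A globular set $X$ is a sequence of sets $X_i$ ($i\ge 0$; elements are called $i$-cells) with functions $dom_{i-1}^i,cod_{i-1}^i:X_i\to X_{i-1}$ ($i>0$) satisfying $dom_{i-1}^i dom_i^{i+1}=dom_{i-1}^i cod_i^{i+1}$ and $cod_{i-1}^i dom_i^{i+1}=cod_{i-1}^i cod_i^{i+1}$. For $i<j$, $dom_i^j,cod_i^j:X_j\to X_i$ are the iterated composites. An omega graph is a globular set with functions $id_i^{i-1}:X_{i-1}\to X_i$ ($i>0$) with $dom_{i-1}^i id_i^{i-1}x=x=cod_{i-1}^i id_i^{i-1}x$; $id_j^i$ denotes the iterated composite $X_i\to X_j$. An omega magma is an omega graph with, for all $0\le i<j$, a partial binary operation $a\circ_i^j b$ on $j$-cells, defined exactly when $cod_i^j a=dom_i^j b$, such that: if $i+1=j$, then $dom_i^j(a\circ_i^j b)=dom_i^j a$ and $cod_i^j(a\circ_i^j b)=cod_i^j b$; if $i+1<j$, then $dom_{j-1}^j(a\circ_i^j b)=dom_{j-1}^ja\circ_i^{j-1}dom_{j-1}^jb$ and likewise for $cod_{j-1}^j$. Morphisms of globular sets, omega graphs and omega magmas preserve all the respective structure. A strict omega category is an omega magma in which (whenever the composites are defined) $(a\circ_i^jb)\circ_i^jc=a\circ_i^j(b\circ_i^jc)$;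 $(a\circ_j^kb)\circ_i^k(c\circ_j^kd)=(a\circ_i^kc)\circ_j^k(b\circ_i^kd)$ for $i<j<k$; $a=id_j^i(dom_i^ja)\circ_i^ja=a\circ_i^jid_j^i(cod_i^ja)$; and $id_{j+1}^j(a)\circ_i^{j+1}id_{j+1}^j(b)=id_{j+1}^j(a\circ_i^jb)$ for $i<j$. Two $i$-cells $a,b$ are parallel, $a\parallel b$, if they have the same $dom_{i-1}^i$ and the same $cod_{i-1}^i$; any two $0$-cells are parallel. A bridge relation $R$ on an omega graph (or omega magma) $X$ is a sequence $R_i\subseteq X_i\times X_i\times X_{i+1}$ ($i\ge0$) such that: $(a,b,c)\in R_i$ implies $a\parallel b$, $dom_i^{i+1}c=a$, $cod_i^{i+1}c=b$; $(a,a,id_{i+1}^ia)\in R_i$ for all $a\in X_i$; $(a,b,c),(a,b,d)\in R_i$ implies $c=d$. The diagonal bridge relation $R^\Delta$ consists of all triples $(a,a,id_{i+1}^ia)$. A bridge morphism $F:(X,R^X)\to(Y,R^Y)$ is an omega magma morphism with $(a,b,c)\in R_i^X\Rightarrow(Fa,Fb,Fc)\in R_i^Y$. A categorical Penon morphism is a bridge morphism $F:(X,R^X)\to(Y,R^Y)$ such that $Y$ is a strict omega category, $R^Y=R^\Delta$; $(a,b,c)\in R_i^X$ implies $Fa=Fb$ and $Fc=id_{i+1}^i(Fa)$; and if $a,b\in X_i$, $a\parallel b$, $Fa=Fb$, then there is $c$ with $(a,b,c)\in R_i^X$. A weak omega category $\mathbf X$ consists of omega magmas $X_1$ (the underlying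 magma) and $X_2$, an omega magma morphism $\lambda^X:X_2\to X_1$, a morphism $\rho^X:X_1\to X_2$ of omega graphs with $\lambda^X\circ\rho^X=1$ (as omega graph morphisms), a bridge relation $R^X$ on $X_2$, a strict omega category $X_3$, and a categorical Penon morphism $\kappa^X:(X_2,R^X)\to(X_3,R^\Delta)$. An omega pseudo-functor $\mathbf F:\mathbf X\to\mathbf Y$ is a triple of morphisms of globular sets $F_i:X_i\to Y_i$ ($i=1,2,3$) such that $F_3$ is a morphism of omega graphs; $F_1\lambda^X=\lambda^YF_2$ and $F_3\kappa^X=\kappa^YF_2$ as morphisms of globular sets; and $\kappa^Y(F_2a\circ_{j-1}^jF_2b)=\kappa^YF_2(a\circ_{j-1}^jb)$ whenever $a\circ_{j-1}^jb$ is defined in $X_2$. (It is not required that $F_2\rho^X=\rho^YF_1$.) *)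

theory Defs
  imports Main
begin

text \<open>
  The cells of all dimensions are drawn from one type, and the set of \<open>i\<close>-cells is the subset
  \<open>cells X i\<close> of it; the sets for different \<open>i\<close> need not be disjoint.
  \<open>gdom X i\<close> and \<open>gcod X i\<close> are the maps from \<open>(i+1)\<close>-cells to \<open>i\<close>-cells, \<open>idn X i\<close> is the
  map from \<open>i\<close>-cells to \<open>(i+1)\<close>-cells, and \<open>comp X i j\<close> is the composition of \<open>j\<close>-cells along
  \<open>i\<close>-cells.  All maps are total functions whose values matter only on cells of the right
  dimension (for \<open>comp\<close>: on composable pairs).
\<close>

record 'a globular =
  cells :: "nat \<Rightarrow> 'a set"
  gdom :: "nat \<Rightarrow> 'a \<Rightarrow> 'a"
  gcod :: "nat \<Rightarrow> 'a \<Rightarrow> 'a"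

record 'a omega_graph = "'a globular" +
  idn :: "nat \<Rightarrow> 'a \<Rightarrow> 'a"

record 'a omega_magma = "'a omega_graph" +
  comp :: "nat \<Rightarrow> nat \<Rightarrow> 'a \<Rightarrow> 'a \<Rightarrow> 'a"

locale globular_set =
  fixes X :: "('a, 'm) globular_scheme"
  assumes gdom_cells: "a \<in> cells X (Suc i) \<Longrightarrow> gdom X i a \<in> cells X i"
    and gcod_cells: "a \<in> cells X (Suc i) \<Longrightarrow> gcod X i a \<in> cells X i"
    and gdom_gdom: "a \<in> cells X (Suc (Suc i)) \<Longrightarrow>
      gdom X i (gdom X (Suc i) a) = gdom X i (gcod X (Suc i) a)"
    and gcod_gdom: "a \<in> cells X (Suc (Suc i)) \<Longrightarrow>
      gcod X i (gdom X (Suc i) a) = gcod X i (gcod X (Suc i) a)"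

text \<open>\<open>gdom_iter X i j\<close> and \<open>gcod_iter X i j\<close> map \<open>j\<close>-cells to \<open>i\<close>-cells, for \<open>i \<le> j\<close>.\<close>

primrec gdom_iter :: "('a, 'm) globular_scheme \<Rightarrow> nat \<Rightarrow> nat \<Rightarrow> 'a \<Rightarrow> 'a" where
  "gdom_iter X i 0 a = a"
| "gdom_iter X i (Suc j) a = (if i \<le> j then gdom_iter X i j (gdom X j a) else a)"

primrec gcod_iter :: "('a, 'm) globular_scheme \<Rightarrow> nat \<Rightarrow> nat \<Rightarrow> 'a \<Rightarrow> 'a" where
  "gcod_iter X i 0 a = a"
| "gcod_iter X i (Suc j) a = (if i \<le> j then gcod_iter X i j (gcod X j a) else a)"

locale omega_graph = globular_set X for X :: "('a, 'm) omega_graph_scheme" +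
  assumes idn_cells: "a \<in> cells X i \<Longrightarrow> idn X i a \<in> cells X (Suc i)"
    and gdom_idn: "a \<in> cells X i \<Longrightarrow> gdom X i (idn X i a) = a"
    and gcod_idn: "a \<in> cells X i \<Longrightarrow> gcod X i (idn X i a) = a"

text \<open>\<open>idn_iter X i j\<close> maps \<open>i\<close>-cells to \<open>j\<close>-cells, for \<open>i \<le> j\<close>.\<close>

primrec idn_iter :: "('a, 'm) omega_graph_scheme \<Rightarrow> nat \<Rightarrow> nat \<Rightarrow> 'a \<Rightarrow> 'a" where
  "idn_iter X i 0 a = a"
| "idn_iter X i (Suc j) a = (if i \<le> j then idn X j (idn_iter X i j a) else a)"

text \<open>The domain of definition of the partial operation \<open>comp X i j\<close>.\<close>

definition composable :: "('a, 'm) globular_scheme \<Rightarrow> nat \<Rightarrow> nat \<Rightarrow> 'a \<Rightarrow> 'a \<Rightarrow> bool" where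
  "composable X i j a b \<longleftrightarrow>
     i < j \<and> a \<in> cells X j \<and> b \<in> cells X j \<and> gcod_iter X i j a = gdom_iter X i j b"

locale omega_magma = omega_graph X for X :: "('a, 'm) omega_magma_scheme" +
  assumes comp_cells: "composable X i j a b \<Longrightarrow> comp X i j a b \<in> cells X j"
    and gdom_comp: "composable X i (Suc i) a b \<Longrightarrow>
      gdom X i (comp X i (Suc i) a b) = gdom X i a"
    and gcod_comp: "composable X i (Suc i) a b \<Longrightarrow>
      gcod X i (comp X i (Suc i) a b) = gcod X i b"
    and gdom_comp_lower: "composable X i (Suc j) a b \<Longrightarrow> i < j \<Longrightarrow>
      gdom X j (comp X i (Suc j) a b) = comp X i j (gdom X j a) (gdom X j b)"
    and gcod_comp_lower: "composable X i (Suc j) a b \<Longrightarrow> i < j \<Longrightarrow>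
      gcod X j (comp X i (Suc j) a b) = comp X i j (gcod X j a) (gcod X j b)"

locale strict_omega_category = omega_magma X for X :: "('a, 'm) omega_magma_scheme" +
  assumes comp_assoc:
    "composable X i j a b \<Longrightarrow> composable X i j (comp X i j a b) c \<Longrightarrow>
     composable X i j b c \<Longrightarrow> composable X i j a (comp X i j b c) \<Longrightarrow>
      comp X i j (comp X i j a b) c = comp X i j a (comp X i j b c)"
    and interchange:
    "i < j \<Longrightarrow> j < k \<Longrightarrow>
     composable X j k a b \<Longrightarrow> composable X j k c d \<Longrightarrow>
     composable X i k (comp X j k a b) (comp X j k c d) \<Longrightarrow>
     composable X i k a c \<Longrightarrow> composable X i k b d \<Longrightarrow>
     composable X j k (comp X i k a c) (comp X i k b d) \<Longrightarrow>
      comp X i k (comp X j k a b) (comp X j k c d) = comp X j k (comp X i k a c) (comp X i k b d)"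
    and comp_unit_left: "i < j \<Longrightarrow> a \<in> cells X j \<Longrightarrow>
      comp X i j (idn_iter X i j (gdom_iter X i j a)) a = a"
    and comp_unit_right: "i < j \<Longrightarrow> a \<in> cells X j \<Longrightarrow>
      comp X i j a (idn_iter X i j (gcod_iter X i j a)) = a"
    and comp_idn: "composable X i j a b \<Longrightarrow>
      comp X i (Suc j) (idn X j a) (idn X j b) = idn X j (comp X i j a b)"

locale globular_morphism = X: globular_set X + Y: globular_set Y
  for X :: "('a, 'm) globular_scheme" and Y :: "('b, 'n) globular_scheme" +
  fixes f :: "nat \<Rightarrow> 'a \<Rightarrow> 'b"
  assumes map_cells: "a \<in> cells X i \<Longrightarrow> f i a \<in> cells Y i"
    and map_gdom: "a \<in> cells X (Suc i) \<Longrightarrow> f i (gdom X i a) = gdom Y i (f (Suc i) a)"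
    and map_gcod: "a \<in> cells X (Suc i) \<Longrightarrow> f i (gcod X i a) = gcod Y i (f (Suc i) a)"

locale omega_graph_morphism =
  globular_morphism X Y f + X: omega_graph X + Y: omega_graph Y
  for X :: "('a, 'm) omega_graph_scheme" and Y :: "('b, 'n) omega_graph_scheme" and f +
  assumes map_idn: "a \<in> cells X i \<Longrightarrow> f (Suc i) (idn X i a) = idn Y i (f i a)"

locale omega_magma_morphism =
  omega_graph_morphism X Y f + X: omega_magma X + Y: omega_magma Y
  for X :: "('a, 'm) omega_magma_scheme" and Y :: "('b, 'n) omega_magma_scheme" and f +
  assumes map_comp: "composable X i j a b \<Longrightarrow>
      f j (comp X i j a b) = comp Y i j (f j a) (f j b)"

text \<open>Composition of morphisms, and equality of morphisms with source \<open>X\<close>: the underlying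
  functions are only compared on the cells of \<open>X\<close>.\<close>

definition mor_comp :: "(nat \<Rightarrow> 'b \<Rightarrow> 'c) \<Rightarrow> (nat \<Rightarrow> 'a \<Rightarrow> 'b) \<Rightarrow> nat \<Rightarrow> 'a \<Rightarrow> 'c" where
  "mor_comp g f = (\<lambda>i. g i \<circ> f i)"

definition mor_eq ::
  "('a, 'm) globular_scheme \<Rightarrow> (nat \<Rightarrow> 'a \<Rightarrow> 'b) \<Rightarrow> (nat \<Rightarrow> 'a \<Rightarrow> 'b) \<Rightarrow> bool" where
  "mor_eq X f g \<longleftrightarrow> (\<forall>i. \<forall>a \<in> cells X i. f i a = g i a)"

definition parallel :: "('a, 'm) globular_scheme \<Rightarrow> nat \<Rightarrow> 'a \<Rightarrow> 'a \<Rightarrow> bool" where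
  "parallel X i a b \<longleftrightarrow> a \<in> cells X i \<and> b \<in> cells X i \<and>
     (\<forall>k. i = Suc k \<longrightarrow> gdom X k a = gdom X k b \<and> gcod X k a = gcod X k b)"

locale bridge_relation = omega_graph X for X :: "('a, 'm) omega_graph_scheme" +
  fixes R :: "nat \<Rightarrow> ('a \<times> 'a \<times> 'a) set"
  assumes bridge_cells: "R i \<subseteq> cells X i \<times> cells X i \<times> cells X (Suc i)"
    and bridge_boundary: "(a, b, c) \<in> R i \<Longrightarrow>
      parallel X i a b \<and> gdom X i c = a \<and> gcod X i c = b"
    and bridge_idn: "a \<in> cells X i \<Longrightarrow> (a, a, idn X i a) \<in> R i"
    and bridge_unique: "(a, b, c) \<in> R i \<Longrightarrow> (a, b, d) \<in> R i \<Longrightarrow> c = d"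

definition diagonal_bridge :: "('a, 'm) omega_graph_scheme \<Rightarrow> nat \<Rightarrow> ('a \<times> 'a \<times> 'a) set" where
  "diagonal_bridge X i = {(a, a, idn X i a) | a. a \<in> cells X i}"

locale bridge_morphism =
  omega_magma_morphism X Y f + X: bridge_relation X R + Y: bridge_relation Y S
  for X :: "('a, 'm) omega_magma_scheme" and R
    and Y :: "('b, 'n) omega_magma_scheme" and S and f +
  assumes map_bridge: "(a, b, c) \<in> R i \<Longrightarrow> (f i a, f i b, f (Suc i) c) \<in> S i"

locale categorical_Penon_morphism =
  bridge_morphism X R Y S f + Y: strict_omega_category Y
  for X :: "('a, 'm) omega_magma_scheme" and R
    and Y :: "('b, 'n) omega_magma_scheme" and S and f +
  assumes target_diagonal: "S = diagonal_bridge Y"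
    and bridge_collapse: "(a, b, c) \<in> R i \<Longrightarrow>
      f i a = f i b \<and> f (Suc i) c = idn Y i (f i a)"
    and bridge_exists: "parallel X i a b \<Longrightarrow> f i a = f i b \<Longrightarrow> \<exists>c. (a, b, c) \<in> R i"

record ('a, 'b, 'c) weak_omega =
  magma1 :: "'a omega_magma"
  magma2 :: "'b omega_magma"
  strict3 :: "'c omega_magma"
  lam :: "nat \<Rightarrow> 'b \<Rightarrow> 'a"
  rho :: "nat \<Rightarrow> 'a \<Rightarrow> 'b"
  bridge :: "nat \<Rightarrow> ('b \<times> 'b \<times> 'b) set"
  kap :: "nat \<Rightarrow> 'b \<Rightarrow> 'c"

locale weak_omega_category =
  fixes X :: "('a, 'b, 'c) weak_omega"
  assumes magma1: "omega_magma (magma1 X)"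
    and magma2: "omega_magma (magma2 X)"
    and strict3: "strict_omega_category (strict3 X)"
    and lam: "omega_magma_morphism (magma2 X) (magma1 X) (lam X)"
    and rho: "omega_graph_morphism (magma1 X) (magma2 X) (rho X)"
    and lam_rho: "mor_eq (magma1 X) (mor_comp (lam X) (rho X)) (\<lambda>i. id)"
    and bridge: "bridge_relation (magma2 X) (bridge X)"
    and kap: "categorical_Penon_morphism (magma2 X) (bridge X)
      (strict3 X) (diagonal_bridge (strict3 X)) (kap X)"

record ('a, 'b, 'c, 'd, 'e, 'f) map_triple =
  map1 :: "nat \<Rightarrow> 'a \<Rightarrow> 'd"
  map2 :: "nat \<Rightarrow> 'b \<Rightarrow> 'e"
  map3 :: "nat \<Rightarrow> 'c \<Rightarrow> 'f"

locale omega_pseudo_functor = X: weak_omega_category X + Y: weak_omega_category Y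
  for X :: "('a, 'b, 'c) weak_omega" and Y :: "('d, 'e, 'f) weak_omega" +
  fixes F :: "('a, 'b, 'c, 'd, 'e, 'f) map_triple"
  assumes map1: "globular_morphism (magma1 X) (magma1 Y) (map1 F)"
    and map2: "globular_morphism (magma2 X) (magma2 Y) (map2 F)"
    and map3: "omega_graph_morphism (strict3 X) (strict3 Y) (map3 F)"
    and map_lam: "mor_eq (magma2 X) (mor_comp (map1 F) (lam X)) (mor_comp (lam Y) (map2 F))"
    and map_kap: "mor_eq (magma2 X) (mor_comp (map3 F) (kap X)) (mor_comp (kap Y) (map2 F))"
    and map_comp_top: "composable (magma2 X) j (Suc j) a b \<Longrightarrow>
      kap Y (Suc j) (comp (magma2 Y) j (Suc j) (map2 F (Suc j) a) (map2 F (Suc j) b))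
        = kap Y (Suc j) (map2 F (Suc j) (comp (magma2 X) j (Suc j) a b))"

definition pseudo_functor_comp ::
  "('d, 'e, 'f, 'g, 'h, 'k) map_triple \<Rightarrow> ('a, 'b, 'c, 'd, 'e, 'f) map_triple \<Rightarrow>
   ('a, 'b, 'c, 'g, 'h, 'k) map_triple" where
  "pseudo_functor_comp G F =
     \<lparr>map1 = mor_comp (map1 G) (map1 F),
      map2 = mor_comp (map2 G) (map2 F),
      map3 = mor_comp (map3 G) (map3 F)\<rparr>"

end

theory Submission imports Defs begin

text \<open>
  Everything except the condition on composites is closed under composition by pasting
  commuting squares.  For that condition, write \<open>\<circ>\<close> for composition of \<open>(j+1)\<close>-cells along
  their common \<open>j\<close>-cell.  The maps \<open>F\<^sub>2\<close> and \<open>G\<^sub>2\<close> need not preserve composites; they do so only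
  after applying \<open>\<kappa>\<close>.  A failure of \<open>F\<^sub>2\<close> to preserve \<open>a \<circ> b\<close> is therefore invisible to
  \<open>\<kappa>\<^sup>Y\<close>, and \<open>\<kappa>\<^sup>Z G\<^sub>2\<close> cannot see it either, because it factors through \<open>\<kappa>\<^sup>Y\<close> as
  \<open>G\<^sub>3 \<kappa>\<^sup>Y\<close>:

  \<open>\<kappa>\<^sup>Z (G\<^sub>2 F\<^sub>2 a \<circ> G\<^sub>2 F\<^sub>2 b) = \<kappa>\<^sup>Z G\<^sub>2 (F\<^sub>2 a \<circ> F\<^sub>2 b) = G\<^sub>3 \<kappa>\<^sup>Y (F\<^sub>2 a \<circ> F\<^sub>2 b)
    = G\<^sub>3 \<kappa>\<^sup>Y F\<^sub>2 (a \<circ> b) = \<kappa>\<^sup>Z G\<^sub>2 F\<^sub>2 (a \<circ> b)\<close>.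

  The first step applies the condition for \<open>G\<close> to the pair \<open>F\<^sub>2a, F\<^sub>2b\<close>, which is composable
  in \<open>Y\<^sub>2\<close> because \<open>F\<^sub>2\<close> is a globular morphism (lemma \<open>composable_map_Suc\<close>).
\<close>

lemma gdom_iter_same: "gdom_iter X j j a = a"
  by (cases j) auto

lemma gcod_iter_same: "gcod_iter X j j a = a"
  by (cases j) auto

lemma composable_Suc_iff:
  "composable X j (Suc j) a b \<longleftrightarrow>
     a \<in> cells X (Suc j) \<and> b \<in> cells X (Suc j) \<and> gcod X j a = gdom X j b"
  by (simp add: composable_def gdom_iter_same gcod_iter_same)

lemma (in globular_morphism) composable_map_Suc:
  assumes "composable X j (Suc j) a b"
  shows "composable Y j (Suc j) (f (Suc j) a) (f (Suc j) b)"
  using assms by (metis composable_Suc_iff map_cells map_gcod map_gdom)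

lemma globular_morphism_mor_comp:
  assumes "globular_morphism X Y f" and "globular_morphism Y Z g"
  shows "globular_morphism X Z (mor_comp g f)"
proof -
  interpret f: globular_morphism X Y f by fact
  interpret g: globular_morphism Y Z g by fact
  show ?thesis
    by unfold_locales
      (simp_all add: mor_comp_def f.map_cells g.map_cells f.map_gdom f.map_gcod
        flip: g.map_gdom g.map_gcod)
qed

lemma omega_graph_morphism_mor_comp:
  assumes "omega_graph_morphism X Y f" and "omega_graph_morphism Y Z g"
  shows "omega_graph_morphism X Z (mor_comp g f)"
proof -
  interpret f: omega_graph_morphism X Y f by fact
  interpret g: omega_graph_morphism Y Z g by fact
  interpret gf: globular_morphism X Z "mor_comp g f"
    by (rule globular_morphism_mor_comp) unfold_locales
  show ?thesis
    by unfold_locales (simp add: mor_comp_def f.map_cells f.map_idn g.map_idn)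
qed

text \<open>
  Equality of morphisms is tested only on cells of the source, so the second square may be used
  only at values of \<open>f\<close>; this is where \<open>f\<close> has to map cells to cells.
\<close>

lemma mor_eq_paste_squares:
  assumes "globular_morphism X Y f"
    and "mor_eq X (mor_comp f' p) (mor_comp q f)"
    and "mor_eq Y (mor_comp g' q) (mor_comp r g)"
  shows "mor_eq X (mor_comp (mor_comp g' f') p) (mor_comp r (mor_comp g f))"
  using assms(2,3) globular_morphism.map_cells[OF assms(1)]
  by (simp add: mor_eq_def mor_comp_def)

theorem proposition31:
  fixes X :: "('a, 'b, 'c) weak_omega"
    and Y :: "('d, 'e, 'f) weak_omega"
    and Z :: "('g, 'h, 'k) weak_omega"
    and F :: "('a, 'b, 'c, 'd, 'e, 'f) map_triple"
    and G :: "('d, 'e, 'f, 'g, 'h, 'k) map_triple"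
  assumes "weak_omega_category X" and "weak_omega_category Y" and "weak_omega_category Z"
    and "omega_pseudo_functor X Y F"
    and "omega_pseudo_functor Y Z G"
  shows "omega_pseudo_functor X Z (pseudo_functor_comp G F)"
proof -
  interpret F: omega_pseudo_functor X Y F by fact
  interpret G: omega_pseudo_functor Y Z G by fact
  interpret F2: globular_morphism "magma2 X" "magma2 Y" "map2 F" by (rule F.map2)
  interpret X2: omega_magma "magma2 X" by (rule F.X.magma2)
  interpret Y2: omega_magma "magma2 Y" by (rule F.Y.magma2)
  have G3: "kap Z i (map2 G i u) = map3 G i (kap Y i u)" if "u \<in> cells (magma2 Y) i" for i u
    using G.map_kap that by (simp add: mor_eq_def mor_comp_def)
  have comp_top:
    "kap Z (Suc j) (comp (magma2 Z) j (Suc j)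
        (map2 G (Suc j) (map2 F (Suc j) a)) (map2 G (Suc j) (map2 F (Suc j) b)))
      = kap Z (Suc j) (map2 G (Suc j) (map2 F (Suc j) (comp (magma2 X) j (Suc j) a b)))"
    (is "?lhs = ?rhs")
    if ab: "composable (magma2 X) j (Suc j) a b" for j a b
  proof -
    let ?Fa = "map2 F (Suc j) a" and ?Fb = "map2 F (Suc j) b"
    have Fab: "composable (magma2 Y) j (Suc j) ?Fa ?Fb"
      by (rule F2.composable_map_Suc[OF ab])
    have "?lhs = kap Z (Suc j) (map2 G (Suc j) (comp (magma2 Y) j (Suc j) ?Fa ?Fb))"
      by (rule G.map_comp_top[OF Fab])
    also have "\<dots> = map3 G (Suc j) (kap Y (Suc j) (comp (magma2 Y) j (Suc j) ?Fa ?Fb))"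
      by (rule G3[OF Y2.comp_cells[OF Fab]])
    also have "\<dots> = map3 G (Suc j)
        (kap Y (Suc j) (map2 F (Suc j) (comp (magma2 X) j (Suc j) a b)))"
      by (simp only: F.map_comp_top[OF ab])
    also have "\<dots> = ?rhs"
      by (rule G3[OF F2.map_cells[OF X2.comp_cells[OF ab]], symmetric])
    finally show ?thesis .
  qed
  show ?thesis
  proof (intro omega_pseudo_functor.intro omega_pseudo_functor_axioms.intro,
      unfold pseudo_functor_comp_def map_triple.simps)
    show "weak_omega_category X" "weak_omega_category Z" by fact+
    show "globular_morphism (magma1 X) (magma1 Z) (mor_comp (map1 G) (map1 F))"
      by (rule globular_morphism_mor_comp[OF F.map1 G.map1])
    show "globular_morphism (magma2 X) (magma2 Z) (mor_comp (map2 G) (map2 F))"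
      by (rule globular_morphism_mor_comp[OF F.map2 G.map2])
    show "omega_graph_morphism (strict3 X) (strict3 Z) (mor_comp (map3 G) (map3 F))"
      by (rule omega_graph_morphism_mor_comp[OF F.map3 G.map3])
    show "mor_eq (magma2 X) (mor_comp (mor_comp (map1 G) (map1 F)) (lam X))
        (mor_comp (lam Z) (mor_comp (map2 G) (map2 F)))"
      by (rule mor_eq_paste_squares[OF F.map2 F.map_lam G.map_lam])
    show "mor_eq (magma2 X) (mor_comp (mor_comp (map3 G) (map3 F)) (kap X))
        (mor_comp (kap Z) (mor_comp (map2 G) (map2 F)))"
      by (rule mor_eq_paste_squares[OF F.map2 F.map_kap G.map_kap])
  qed (simp add: mor_comp_def comp_top)
qed

end
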